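(* Let $(q_n)_{n \ge 1}$ be a sequence of positive rational numbers, and let $(p_n)_{n \ge 1}$ be a sequence of pairwise distinct prime numbers such that $\gcd(p_i, \mathsf{n}(q_i)) = \gcd(p_i, \mathsf{d}(q_j)) = 1$ for all $i,j \in \mathbb{N}$. Let $M := \big\langle \frac{q_n}{p_n} \mid n \in \mathbb{N} \big\rangle$ be the Puiseux monoid of $(q_n)_{n \ge 1}$ atomized at $(p_n)_{n \ge 1}$. Then the following statements hold. (1) For each $j \in \mathbb{N}$, the length-$p_j$ factorization $p_j \frac{q_j}{p_j}$ (the formal sum of $p_j$ copies of the atom $\frac{q_j}{p_j}$) is an isolated vertex in the Betti graph $\nabla_{q_j}$ of $q_j$ in $M$. (2) $\mathrm{Betti}(M) \subseteq \langle q_n \mid n \in \mathbb{N} \rangle$. (3) If the monoid $\langle q_n \mid n \in \mathbb{N} \rangle$ is antimatter, then $\{q_n \mid n \in \mathbb{N}\} \subseteq \mathrm{Betti}(M)$. (4) If the monoid $\langle q_n \mid n \in \mathbb{N} \rangle$ is a valuation monoid, then $\mathrm{Betti}(M) \subseteq \{q_n \mid n \in \mathbb{N}\}$.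
   Context: $\mathbb{N}$ is the set of positive integers. For $q \in \mathbb{Q}_{>0}$, $\mathsf{n}(q)$ and $\mathsf{d}(q)$ are the unique positive integers with $\gcd(\mathsf{n}(q),\mathsf{d}(q))=1$ and $q = \mathsf{n}(q)/\mathsf{d}(q)$. A Puiseux monoid is an additive submonoid of $\mathbb{Q}_{\ge 0}$ (so its only invertible element is $0$). For a set $S$ of nonnegative rationals, $\langle S \rangle$ is the additive submonoid of $\mathbb{Q}_{\ge 0}$ generated by $S$. Let $M$ be a Puiseux monoid. An atom of $M$ is a nonzero element that is not the sum of two nonzero elements of $M$; $\mathcal{A}(M)$ is the set of atoms. $M$ is atomic if every nonzero element is a finite sum of atoms (repetitions allowed). $M$ is antimatter if $\mathcal{A}(M)=\emptyset$. For $b,c \in M$, $b \mid_M c$ means $c = b+b'$ for some $b' \in M$; $M$ is a valuation monoid if for all $b,c\in M$ either $b \mid_M c$ or $c \mid_M b$. A factorization is an element of the free commutative monoid $\mathsf{Z}(M)$ on $\mathcal{A}(M)$ (a formal sum of atoms); its length is the number of atoms in it counted with repetition. $\mathsf{Z}(b)$ is the set of factorizations whose sum in $M$ is $b$. For $z,z' \in \mathsf{Z}(M)$, $\gcd(z,z')$ is the factorization consisting of all atoms common to $z$ and $z'$ (counting repetitions). The Betti graph $\nabla_b$ of $b \in M$ has vertex set $\mathsf{Z}(b)$ and an edge between distinct $z,z' \in \mathsf{Z}(b)$ exactly when $\gcd(z,z') \ne 0$, i.e., when they share at least one atom. An element $b$ is a Betti element if $\nabla_b$ is disconnected (has at least two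 connected components); $\mathrm{Betti}(M)$ is the set of Betti elements of $M$. Under the hypotheses on $(q_n)$ and $(p_n)$ in the statement, the monoid $M = \langle q_n/p_n \mid n \in \mathbb{N}\rangle$ is called the Puiseux monoid of $(q_n)_{n\ge1}$ atomized at $(p_n)_{n\ge1}$; it is a known fact that $M$ is atomic with $\mathcal{A}(M) = \{q_n/p_n \mid n \in \mathbb{N}\}$. *)

theory Defs
  imports Complex_Main "HOL-Library.Multiset" "HOL-Computational_Algebra.Primes"
    "Graph_Theory.Graph_Theory"
begin

definition rat_num :: "rat \<Rightarrow> int" where
  "rat_num q = fst (quotient_of q)"

definition rat_den :: "rat \<Rightarrow> int" where
  "rat_den q = snd (quotient_of q)"

definition puiseux_monoid :: "rat set \<Rightarrow> bool" where
  "puiseux_monoid M \<longleftrightarrow> M \<subseteq> {0..} \<and> 0 \<in> M \<and> (\<forall>x\<in>M. \<forall>y\<in>M. x + y \<in> M)"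

(* The smallest Puiseux monoid containing S. Only meaningful for sets S of nonnegative
   rationals; for any other S the hull is an empty intersection, i.e. UNIV. *)
definition gen_monoid :: "rat set \<Rightarrow> rat set" where
  "gen_monoid S = puiseux_monoid hull S"

lemma puiseux_monoid_gen_monoid:
  assumes "S \<subseteq> {0..}"
  shows "puiseux_monoid (gen_monoid S)"
proof -
  have "puiseux_monoid {0..}"
    by (auto simp: puiseux_monoid_def)
  then show ?thesis
    using assms unfolding gen_monoid_def hull_def puiseux_monoid_def by blast
qed

definition atoms :: "rat set \<Rightarrow> rat set" where
  "atoms M = {a \<in> M. a \<noteq> 0 \<and> \<not> (\<exists>b\<in>M. \<exists>c\<in>M. b \<noteq> 0 \<and> c \<noteq> 0 \<and> a = b + c)}"

definition antimatter :: "rat set \<Rightarrow> bool" where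
  "antimatter M \<longleftrightarrow> atoms M = {}"

definition divides_in :: "rat set \<Rightarrow> rat \<Rightarrow> rat \<Rightarrow> bool" where
  "divides_in M b c \<longleftrightarrow> (\<exists>b'\<in>M. c = b + b')"

definition valuation_monoid :: "rat set \<Rightarrow> bool" where
  "valuation_monoid M \<longleftrightarrow> (\<forall>b\<in>M. \<forall>c\<in>M. divides_in M b c \<or> divides_in M c b)"

(* The free commutative monoid on the atoms is modelled by finite multisets of atoms:
   the length of a factorization is its size, and the gcd of two factorizations is the
   multiset intersection. *)
definition factorization_monoid :: "rat set \<Rightarrow> rat multiset set" where
  "factorization_monoid M = {z. set_mset z \<subseteq> atoms M}"

definition factorizations :: "rat set \<Rightarrow> rat \<Rightarrow> rat multiset set" where
  "factorizations M b = {z \<in> factorization_monoid M. sum_mset z = b}"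

(* The undirected edge between z and z' is represented by the two arcs (z, z') and (z', z). *)
definition betti_graph :: "rat set \<Rightarrow> rat \<Rightarrow> rat multiset pair_pre_digraph" where
  "betti_graph M b =
     \<lparr> pverts = factorizations M b,
       parcs = {(z, z'). z \<in> factorizations M b \<and> z' \<in> factorizations M b \<and>
                         z \<noteq> z' \<and> z \<inter># z' \<noteq> {#}} \<rparr>"

definition isolated_vertex :: "'a pair_pre_digraph \<Rightarrow> 'a \<Rightarrow> bool" where
  "isolated_vertex G v \<longleftrightarrow>
     v \<in> pverts G \<and> (\<forall>w\<in>pverts G. (v, w) \<notin> parcs G \<and> (w, v) \<notin> parcs G)"

(* The library does not count the empty graph as connected, so it has to be excluded here
   for the condition to mean "at least two connected components". *)
definition disconnected :: "'a pair_pre_digraph \<Rightarrow> bool" where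
  "disconnected G \<longleftrightarrow> pverts G \<noteq> {} \<and> \<not> Digraph_Component.connected (with_proj G)"

definition betti_elements :: "rat set \<Rightarrow> rat set" where
  "betti_elements M = {b \<in> M. disconnected (betti_graph M b)}"

end

theory Submission
  imports Defs
begin

text \<open>Write \<open>N\<close> for the monoid generated by the \<open>q n\<close>. Comparing \<open>p n\<close>-adic valuations, an element
  of \<open>M\<close> determines modulo \<open>p n\<close> how often the atom \<open>q n / p n\<close> occurs in its factorizations. If one
  of these residues is nonzero, all factorizations share an atom and the Betti graph is complete.
  Hence every factorization of a Betti element is a union of blocks, a block being \<open>p n\<close> copies of
  \<open>q n / p n\<close>, and the element lies in \<open>N\<close>. In the graph of \<open>q j\<close>, a factorization containing
  \<open>q j / p j\<close> contains the whole block and is therefore equal to it; a decomposition of \<open>q j\<close> into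
  nonzero elements of \<open>N\<close> provides a second vertex. If \<open>N\<close> is a valuation monoid, exchanging blocks
  connects any two factorizations of an element that is none of the \<open>q n\<close>.\<close>

section \<open>Generated monoids and connectivity of Betti graphs\<close>

text \<open>These sums contain the generators and are closed under addition, and every Puiseux
  monoid containing the generators contains them. Multisets of indices rather than of values are
  used so that \<open>f\<close> may fail to be injective.\<close>

lemma gen_monoid_image:
  assumes "\<And>i. i \<in> I \<Longrightarrow> 0 \<le> f i"
  shows "gen_monoid (f ` I) = {\<Sum>i\<in>#w. f i | w. set_mset w \<subseteq> I}" (is "_ = ?S")
proof
  have nonneg: "0 \<le> (\<Sum>i\<in>#w. f i)" if "set_mset w \<subseteq> I" for w
    using that assms by (induction w) auto
  have "puiseux_monoid ?S"
    unfolding puiseux_monoid_def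
  proof (intro conjI ballI)
    show "?S \<subseteq> {0..}" using nonneg by auto
    show "0 \<in> ?S" by (rule CollectI, rule exI[of _ "{#}"]) simp
    fix x y assume "x \<in> ?S" "y \<in> ?S"
    then obtain v w where "set_mset v \<subseteq> I" "x = (\<Sum>i\<in>#v. f i)" "set_mset w \<subseteq> I" "y = (\<Sum>i\<in>#w. f i)"
      by blast
    then show "x + y \<in> ?S"
      by (intro CollectI exI[of _ "v + w"]) auto
  qed
  moreover have "f ` I \<subseteq> ?S"
  proof
    fix x assume "x \<in> f ` I"
    then obtain i where "i \<in> I" "x = f i" by blast
    then show "x \<in> ?S" by (intro CollectI exI[of _ "{#i#}"]) auto
  qed
  ultimately show "gen_monoid (f ` I) \<subseteq> ?S"
    unfolding gen_monoid_def by (rule hull_minimal[rotated])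
  have monoid: "puiseux_monoid (gen_monoid (f ` I))"
    using assms by (intro puiseux_monoid_gen_monoid) auto
  have "(\<Sum>i\<in>#w. f i) \<in> gen_monoid (f ` I)" if "set_mset w \<subseteq> I" for w
    using that
  proof (induction w)
    case empty
    then show ?case using monoid by (simp add: puiseux_monoid_def)
  next
    case (add i w)
    then have "f i \<in> gen_monoid (f ` I)"
      by (auto simp: gen_monoid_def intro!: hull_inc)
    with add show ?case using monoid by (simp add: puiseux_monoid_def)
  qed
  then show "?S \<subseteq> gen_monoid (f ` I)" by blast
qed

text \<open>Any two vertices are joined by a walk of length at most two through \<open>y\<close>.
  Since \<open>y\<close> may be \<open>z\<close> or \<open>z'\<close>, the condition also covers
  adjacent vertices.\<close>

lemma not_disconnected_betti_graphI:
  assumes "\<And>z z'. z \<in> factorizations M b \<Longrightarrow> z' \<in> factorizations M b \<Longrightarrow> z \<noteq> z' \<Longrightarrow>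
    \<exists>y\<in>factorizations M b. z \<inter># y \<noteq> {#} \<and> y \<inter># z' \<noteq> {#}"
  shows "\<not> disconnected (betti_graph M b)"
proof -
  let ?F = "factorizations M b" and ?E = "parcs (betti_graph M b)"
  have edge: "(x, z) \<in> rtrancl_on ?F (?E\<^sup>s)"
    if "(x, y) \<in> rtrancl_on ?F (?E\<^sup>s)" "y \<in> ?F" "z \<in> ?F" "y \<inter># z \<noteq> {#}" for x y z
  \<comment> \<open>The graph has no loops, so equal vertices give no arc and are treated
    apart.\<close>
  proof (cases "y = z")
    case False
    with that have "(y, z) \<in> ?E\<^sup>s" by (simp add: symcl_def betti_graph_def)
    with that show ?thesis by (blast intro: rtrancl_on_into_rtrancl_on)
  qed (use that in simp)
  have "(z, z') \<in> rtrancl_on ?F (?E\<^sup>s)" if "z \<in> ?F" "z' \<in> ?F" for z z'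
  proof (cases "z = z'")
    case False
    then obtain y where "y \<in> ?F" "z \<inter># y \<noteq> {#}" "y \<inter># z' \<noteq> {#}"
      using assms \<open>z \<in> ?F\<close> \<open>z' \<in> ?F\<close> by blast
    then show ?thesis
      using edge[OF edge[OF rtrancl_on_refl]] \<open>z \<in> ?F\<close> \<open>z' \<in> ?F\<close> by blast
  qed (use \<open>z' \<in> ?F\<close> in simp)
  then show ?thesis
    by (simp add: disconnected_def connected_conv) (simp add: betti_graph_def)
qed

lemma isolated_vertex_disconnected:
  assumes "isolated_vertex G v" "w \<in> pverts G" "v \<noteq> w"
  shows "disconnected G"
proof -
  have "x = v" if "(v, x) \<in> rtrancl_on (pverts G) ((parcs G)\<^sup>s)" for x
    using that
  proof (induction x)
    case (step b c)
    then show ?case using assms(1) by (fastforce simp: isolated_vertex_def symcl_def)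
  qed simp
  then show ?thesis
    using assms by (auto simp: disconnected_def connected_conv isolated_vertex_def)
qed

section \<open>Rationals integral at a prime\<close>

text \<open>For prime \<open>p\<close> this is the localization of the integers at \<open>p\<close>,
  i.e. nonnegative \<open>p\<close>-adic valuation. The fraction need not be reduced, and
  \<open>b\<close> is nonzero because \<open>p\<close> divides \<open>0\<close>.\<close>

definition integral_at :: "int \<Rightarrow> rat \<Rightarrow> bool" where
  "integral_at p x \<longleftrightarrow> (\<exists>a b. x = of_int a / of_int b \<and> \<not> p dvd b)"

lemma integral_at_zero: "prime p \<Longrightarrow> integral_at p 0"
  unfolding integral_at_def by (rule exI[of _ 0], rule exI[of _ 1]) (auto dest: not_prime_unit)

lemma integral_at_diff:
  assumes "prime p" "integral_at p x" "integral_at p y"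
  shows "integral_at p (x - y)"
proof -
  obtain a b c d where *: "x = of_int a / of_int b" "\<not> p dvd b" "y = of_int c / of_int d" "\<not> p dvd d"
    using assms by (auto simp: integral_at_def)
  then have "b \<noteq> 0" "d \<noteq> 0" by auto
  then have "x - y = of_int (a * d - c * b) / of_int (b * d)"
    using * by (simp add: diff_frac_eq)
  moreover have "\<not> p dvd b * d"
    using * assms(1) by (simp add: prime_dvd_mult_iff)
  ultimately show ?thesis unfolding integral_at_def by blast
qed

lemma integral_at_add:
  assumes "prime p" "integral_at p x" "integral_at p y"
  shows "integral_at p (x + y)"
  using integral_at_diff[OF assms(1,2) integral_at_diff[OF assms(1) integral_at_zero[OF assms(1)] assms(3)]]
  by simp

lemma rat_num_div_den: "x = of_int (rat_num x) / of_int (rat_den x)"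
  unfolding rat_num_def rat_den_def by (rule quotient_of_div) simp

lemma integral_at_div:
  assumes "prime p" "\<not> p dvd rat_den x" "\<not> p dvd k"
  shows "integral_at p (x / of_int k)"
proof -
  have "x / of_int k = of_int (rat_num x) / of_int (rat_den x * k)"
    by (subst rat_num_div_den[of x]) simp
  moreover have "\<not> p dvd rat_den x * k"
    using assms by (simp add: prime_dvd_mult_iff)
  ultimately show ?thesis unfolding integral_at_def by blast
qed

text \<open>Clearing denominators makes \<open>p\<close> divide \<open>m * rat_num x * b\<close>,
  and the last two factors are prime to \<open>p\<close>.\<close>

lemma dvd_of_integral_at:
  assumes "prime p" "\<not> p dvd rat_num x" "integral_at p (of_int m * (x / of_int p))"
  shows "p dvd m"
proof -
  obtain a b where ab: "of_int m * (x / of_int p) = (of_int a / of_int b :: rat)" "\<not> p dvd b"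
    using assms(3) by (auto simp: integral_at_def)
  have nz: "p \<noteq> 0" "b \<noteq> 0" "rat_den x \<noteq> 0"
    using assms(1) ab(2) quotient_of_denom_pos'[of x] by (auto simp: rat_den_def)
  have "of_int m * (of_int (rat_num x) / of_int (rat_den x) / of_int p) = (of_int a / of_int b :: rat)"
    using ab(1) rat_num_div_den[of x] by simp
  then have "(of_int (m * rat_num x * b) :: rat) = of_int (a * rat_den x * p)"
    using nz by (simp add: field_simps)
  then have "m * rat_num x * b = a * rat_den x * p"
    by (simp only: of_int_eq_iff)
  then have "p dvd m * rat_num x * b" by simp
  then show ?thesis using assms(1,2) ab(2) by (simp add: prime_dvd_mult_iff)
qed

section \<open>The atomized monoid, its atoms and the residues of their multiplicities\<close>

locale atomized_sequence =
  fixes I :: "'i set" and q :: "'i \<Rightarrow> rat" and p :: "'i \<Rightarrow> nat"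
  assumes q_pos: "i \<in> I \<Longrightarrow> q i > 0"
    and p_prime: "i \<in> I \<Longrightarrow> prime (p i)"
    and p_inj: "inj_on p I"
    and coprime_num: "i \<in> I \<Longrightarrow> coprime (int (p i)) (rat_num (q i))"
    and coprime_den: "i \<in> I \<Longrightarrow> j \<in> I \<Longrightarrow> coprime (int (p i)) (rat_den (q j))"
begin

definition atom :: "'i \<Rightarrow> rat" where
  "atom i = q i / of_nat (p i)"

text \<open>Factorizations are handled as multisets of indices, because the block length
  \<open>p i\<close> depends on the index. By \<open>atom_inj\<close> this is equivalent to
  multisets of atoms.\<close>

definition val :: "'i multiset \<Rightarrow> rat" where
  "val w = (\<Sum>i\<in>#w. atom i)"

definition M :: "rat set" where
  "M = gen_monoid (atom ` I)"

definition N :: "rat set" where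
  "N = gen_monoid (q ` I)"

lemma val_simps [simp]:
  "val {#} = 0" "val (add_mset i w) = atom i + val w" "val (v + w) = val v + val w"
  by (simp_all add: val_def)

lemma p_pos: "i \<in> I \<Longrightarrow> p i > 0"
  using p_prime prime_gt_0_nat by blast

lemma atom_pos: "i \<in> I \<Longrightarrow> atom i > 0"
  by (simp add: atom_def q_pos p_pos)

lemma val_nonneg: "set_mset w \<subseteq> I \<Longrightarrow> val w \<ge> 0"
  by (induction w) (auto dest: atom_pos intro: add_nonneg_nonneg less_imp_le)

lemma val_pos: "set_mset w \<subseteq> I \<Longrightarrow> w \<noteq> {#} \<Longrightarrow> val w > 0"
  by (cases w) (auto intro!: add_pos_nonneg atom_pos val_nonneg)

lemma val_replicate: "i \<in> I \<Longrightarrow> val (replicate_mset (p i) i) = q i"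
  using p_pos[of i] by (simp add: val_def atom_def)

lemma M_eq: "M = {val w | w. set_mset w \<subseteq> I}"
  unfolding M_def val_def by (rule gen_monoid_image) (use atom_pos in \<open>simp add: less_imp_le\<close>)

lemma N_eq: "N = {\<Sum>i\<in>#w. q i | w. set_mset w \<subseteq> I}"
  unfolding N_def by (rule gen_monoid_image) (use q_pos in \<open>simp add: less_imp_le\<close>)

text \<open>The part of \<open>w\<close> outside \<open>v\<close> has value zero, and atoms are
  positive.\<close>

lemma eq_of_subset_val:
  assumes "set_mset w \<subseteq> I" "v \<subseteq># w" "val v = val w"
  shows "v = w"
proof -
  obtain u where u: "w = v + u" using assms(2) by (auto simp: mset_subset_eq_exists_conv)
  with assms have "val u = 0" "set_mset u \<subseteq> I" by auto
  then have "u = {#}" using val_pos[of u] by auto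
  with u show ?thesis by simp
qed

text \<open>For \<open>i \<noteq> n\<close> the prime \<open>p n\<close> divides neither
  \<open>p i\<close> nor the denominator of \<open>q i\<close>, so only the copies of
  \<open>atom n\<close> can fail to be integral at \<open>p n\<close>.\<close>

lemma val_decomp:
  assumes "set_mset w \<subseteq> I" "n \<in> I"
  shows "integral_at (int (p n)) (val w - of_nat (count w n) * atom n)"
  using assms(1)
proof (induction w)
  case empty
  then show ?case using p_prime[OF assms(2)] by (simp add: integral_at_zero)
next
  case (add i w)
  have pr: "prime (int (p n))" using p_prime[OF assms(2)] by simp
  have IH: "integral_at (int (p n)) (val w - of_nat (count w n) * atom n)"
    using add by simp
  show ?case
  proof (cases "i = n")
    case True
    then show ?thesis using IH by (simp add: algebra_simps)
  next
    case False
    have i: "i \<in> I" using add.prems by simp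
    have "p i \<noteq> p n" using False i assms(2) p_inj by (auto dest: inj_onD)
    then have "\<not> int (p n) dvd int (p i)"
      using p_prime[OF i] p_prime[OF assms(2)] by (simp add: primes_dvd_imp_eq) (metis primes_dvd_imp_eq)
    moreover have "\<not> int (p n) dvd rat_den (q i)"
      using coprime_den[OF assms(2) i] pr by (meson coprime_absorb_left not_prime_unit)
    ultimately have "integral_at (int (p n)) (q i / of_int (int (p i)))"
      using pr by (intro integral_at_div)
    then have "integral_at (int (p n)) (atom i)" by (simp add: atom_def)
    from integral_at_add[OF pr this IH] show ?thesis
      using False by (simp add: algebra_simps)
  qed
qed

text \<open>Subtracting the decompositions of the two equal values shows that the difference of the
  counts times \<open>q n / p n\<close> is integral at \<open>p n\<close>; as \<open>p n\<close>
  does not divide the numerator of \<open>q n\<close>, it divides that difference.\<close>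

lemma count_mod_eq:
  assumes "set_mset v \<subseteq> I" "set_mset w \<subseteq> I" "val v = val w" "n \<in> I"
  shows "count v n mod p n = count w n mod p n"
proof -
  have pr: "prime (int (p n))" using p_prime[OF assms(4)] by simp
  have "integral_at (int (p n))
      ((val w - of_nat (count w n) * atom n) - (val v - of_nat (count v n) * atom n))"
    using assms by (intro integral_at_diff[OF pr] val_decomp)
  also have "(val w - of_nat (count w n) * atom n) - (val v - of_nat (count v n) * atom n) =
      of_int (int (count v n) - int (count w n)) * (q n / of_int (int (p n)))"
    using assms(3) by (simp add: atom_def algebra_simps)
  finally have "int (p n) dvd int (count v n) - int (count w n)"
    using coprime_num[OF assms(4)] pr
    by (intro dvd_of_integral_at[of _ "q n"]) (auto dest: coprime_absorb_left)
  then show ?thesis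
    by (metis mod_eq_dvd_iff of_nat_eq_iff zmod_int)
qed

text \<open>The count of \<open>i\<close> is \<open>1\<close> modulo \<open>p i\<close>, so
  \<open>i\<close> occurs, and one occurrence already exhausts the value.\<close>

lemma val_eq_atom:
  assumes "set_mset w \<subseteq> I" "i \<in> I" "val w = atom i"
  shows "w = {#i#}"
proof -
  have "count w i mod p i = 1"
    using count_mod_eq[OF assms(1), of "{#i#}" i] assms prime_gt_1_nat[OF p_prime[OF assms(2)]]
    by simp
  then have "i \<in># w" by (metis count_eq_zero_iff mod_0 zero_neq_one)
  then have "{#i#} \<subseteq># w" by simp
  from eq_of_subset_val[OF assms(1) this] assms show ?thesis by simp
qed

lemma atom_inj: "inj_on atom I"
proof (rule inj_onI)
  fix i j assume "i \<in> I" "j \<in> I" "atom i = atom j"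
  then show "i = j" using val_eq_atom[of "{#j#}" i] by simp
qed

lemma image_mset_atom_inj:
  assumes "set_mset v \<subseteq> I" "set_mset w \<subseteq> I" "image_mset atom v = image_mset atom w"
  shows "v = w"
proof -
  have "image_mset (inv_into I atom) (image_mset atom u) = u" if "set_mset u \<subseteq> I" for u
    using that by (induction u) (auto simp: atom_inj)
  from this[OF assms(1)] this[OF assms(2)] assms(3) show ?thesis by metis
qed

text \<open>An element with a factorization of size at least two splits. Conversely, a splitting of
  \<open>atom i\<close> would give a factorization of size at least two, against
  \<open>val_eq_atom\<close>.\<close>

lemma atoms_M: "atoms M = atom ` I"
proof
  show "atoms M \<subseteq> atom ` I"
  proof
    fix a assume a: "a \<in> atoms M"
    then obtain w where w: "set_mset w \<subseteq> I" "a = val w" "a \<noteq> 0"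
      by (auto simp: atoms_def M_eq)
    then obtain i v where iv: "w = add_mset i v" by (cases w) auto
    have "v = {#}"
    proof (rule ccontr)
      assume "v \<noteq> {#}"
      moreover have "atom i \<in> M" "val v \<in> M"
        using w iv by (auto simp: M_eq intro: exI[of _ "{#i#}"])
      ultimately show False
        using a w iv atom_pos[of i] val_pos[of v] by (fastforce simp: atoms_def)
    qed
    with w iv show "a \<in> atom ` I" by simp
  qed
  show "atom ` I \<subseteq> atoms M"
  proof
    fix a assume "a \<in> atom ` I"
    then obtain i where i: "i \<in> I" "a = atom i" by blast
    have "a \<in> M" using i by (auto simp: M_eq intro: exI[of _ "{#i#}"])
    moreover have False if bc: "b \<in> M" "c \<in> M" "b \<noteq> 0" "c \<noteq> 0" "a = b + c" for b c
    proof -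
      obtain v w where vw: "set_mset v \<subseteq> I" "b = val v" "set_mset w \<subseteq> I" "c = val w"
        using bc by (auto simp: M_eq)
      then have "v + w = {#i#}" using i bc by (intro val_eq_atom) auto
      then have "v = {#} \<or> w = {#}" by (simp add: union_is_single) blast
      with vw bc show False by auto
    qed
    ultimately show "a \<in> atoms M" using i atom_pos[of i] by (auto simp: atoms_def)
  qed
qed

section \<open>Vertices of the Betti graph and the isolated block\<close>

lemma factorizationsI:
  "set_mset w \<subseteq> I \<Longrightarrow> val w = b \<Longrightarrow> image_mset atom w \<in> factorizations M b"
  by (auto simp: factorizations_def factorization_monoid_def atoms_M val_def)

lemma factorizationsE:
  assumes "z \<in> factorizations M b"
  obtains w where "set_mset w \<subseteq> I" "val w = b" "z = image_mset atom w"
proof -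
  have "\<exists>w. set_mset w \<subseteq> I \<and> z = image_mset atom w" if "set_mset z \<subseteq> atom ` I"
    using that
  proof (induction z)
    case empty
    then show ?case by simp
  next
    case (add x z)
    then obtain i w where "i \<in> I" "x = atom i" "z = image_mset atom w" "set_mset w \<subseteq> I" by auto
    then show ?case by (intro exI[of _ "add_mset i w"]) auto
  qed
  moreover have "set_mset z \<subseteq> atom ` I" "sum_mset z = b"
    using assms by (auto simp: factorizations_def factorization_monoid_def atoms_M)
  ultimately obtain w where w: "set_mset w \<subseteq> I" "z = image_mset atom w" "sum_mset z = b"
    by blast
  then have "val w = b" by (simp add: val_def)
  with w that show thesis by blast
qed

lemma common_atom:
  assumes "i \<in># v" "i \<in># w"
  shows "image_mset atom v \<inter># image_mset atom w \<noteq> {#}"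
proof -
  have "atom i \<in># image_mset atom v \<inter># image_mset atom w"
    using assms by simp
  then show ?thesis by (metis empty_not_add_mset multi_member_split)
qed

lemma replicate_subset:
  assumes "set_mset w \<subseteq> I" "i \<in># w" "p i dvd count w i"
  shows "replicate_mset (p i) i \<subseteq># w"
  using assms by (simp flip: count_le_replicate_mset_subset_eq add: dvd_imp_le)

lemma isolated_vertex_replicate:
  assumes "j \<in> I"
  shows "isolated_vertex (betti_graph M (q j)) (replicate_mset (p j) (atom j))"
proof -
  let ?z = "replicate_mset (p j) (atom j)"
  have z: "?z \<in> factorizations M (q j)"
    using assms val_replicate[OF assms] factorizationsI[of "replicate_mset (p j) j"] by auto
  have "z = ?z" if fact: "z \<in> factorizations M (q j)" and common: "?z \<inter># z \<noteq> {#}" for z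
  proof -
    obtain w where w: "set_mset w \<subseteq> I" "val w = q j" "z = image_mset atom w"
      using fact by (rule factorizationsE)
    obtain x where "x \<in># ?z \<inter># z" using common by blast
    then have "atom j \<in># z" using p_pos[OF assms] by (auto split: if_splits)
    then have j: "j \<in># w" using w assms atom_inj by (auto dest: inj_onD)
    \<comment> \<open>The single block has residue \<open>0\<close> at \<open>j\<close>, hence so
      does \<open>w\<close>; one occurrence of \<open>j\<close> thus forces at least
      \<open>p j\<close> of them.\<close>
    have "p j dvd count w j"
      using count_mod_eq[OF w(1), of "replicate_mset (p j) j" j] w assms val_replicate[OF assms]
      by (auto simp: mod_eq_0_iff_dvd split: if_splits)
    from eq_of_subset_val[OF w(1) replicate_subset[OF w(1) j this]]
    show ?thesis using w val_replicate[OF assms] by auto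
  qed
  with z show ?thesis
    by (auto simp: isolated_vertex_def betti_graph_def subset_mset.inf_commute[of _ ?z])
qed

section \<open>Unions of blocks\<close>

text \<open>Turns a sum of the \<open>q i\<close> in \<open>N\<close> into a factorization in
  \<open>M\<close> of the same element, replacing each summand by its block.\<close>

definition lift :: "'i multiset \<Rightarrow> 'i multiset" where
  "lift w = (\<Sum>i\<in>#w. replicate_mset (p i) i)"

lemma val_lift: "set_mset w \<subseteq> I \<Longrightarrow> val (lift w) = (\<Sum>i\<in>#w. q i)"
  by (induction w) (auto simp: lift_def val_replicate)

lemma set_lift: "set_mset w \<subseteq> I \<Longrightarrow> set_mset (lift w) = set_mset w"
  by (induction w) (auto simp: lift_def dest: p_pos)

text \<open>Blocks are stripped off one at a time; each removal lowers a single count by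
  \<open>p i\<close>, which preserves all divisibilities.\<close>

lemma lift_surj:
  assumes "set_mset w \<subseteq> I" "\<And>n. n \<in> I \<Longrightarrow> p n dvd count w n"
  shows "\<exists>v. set_mset v \<subseteq> I \<and> w = lift v"
  using assms
proof (induction w rule: measure_induct_rule[of size])
  case (less w)
  show ?case
  proof (cases "w = {#}")
    case True
    then show ?thesis by (intro exI[of _ "{#}"]) (simp add: lift_def)
  next
    case False
    then obtain i where i: "i \<in># w" by blast
    then have iI: "i \<in> I" using less.prems by blast
    obtain u where u: "w = replicate_mset (p i) i + u"
      using replicate_subset[OF less.prems(1) i less.prems(2)[OF iI]]
      by (auto simp: mset_subset_eq_exists_conv)
    have "p n dvd count u n" if "n \<in> I" for n
      using less.prems(2)[OF that] u by (auto split: if_splits)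
    moreover have "size u < size w" "set_mset u \<subseteq> I" using u p_pos[OF iI] less.prems(1) by auto
    ultimately obtain v where "set_mset v \<subseteq> I" "u = lift v" using less.IH by blast
    with u iI show ?thesis by (intro exI[of _ "add_mset i v"]) (simp add: lift_def)
  qed
qed

text \<open>A factorization in which some atom occurs with nonzero residue shares that atom with
  every other factorization of the same element.\<close>
lemma betti_factorization_lift:
  assumes "b \<in> betti_elements M" "set_mset w \<subseteq> I" "val w = b"
  shows "\<exists>v. set_mset v \<subseteq> I \<and> w = lift v"
proof (rule lift_surj[OF assms(2)], rule ccontr)
  fix n assume n: "n \<in> I" "\<not> p n dvd count w n"
  have mem: "n \<in># v" if "set_mset v \<subseteq> I" "val v = b" for v
  proof (rule ccontr)
    assume "n \<notin># v"
    then have "count v n mod p n = 0" by (metis mod_0 count_eq_zero_iff)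
    then show False
      using count_mod_eq[OF assms(2) that(1), of n] that assms n by (simp add: mod_eq_0_iff_dvd)
  qed
  have "\<not> disconnected (betti_graph M b)"
  proof (rule not_disconnected_betti_graphI)
    fix z z' assume z: "z \<in> factorizations M b" "z' \<in> factorizations M b"
    then have "z \<inter># z \<noteq> {#} \<and> z \<inter># z' \<noteq> {#}"
      using mem common_atom by (elim factorizationsE) blast
    with z show "\<exists>y\<in>factorizations M b. z \<inter># y \<noteq> {#} \<and> y \<inter># z' \<noteq> {#}" by blast
  qed
  with assms(1) show False by (simp add: betti_elements_def)
qed

section \<open>Location of the Betti elements\<close>

lemma betti_subset_N: "betti_elements M \<subseteq> N"
proof
  fix b assume b: "b \<in> betti_elements M"
  then obtain w where w: "set_mset w \<subseteq> I" "val w = b"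
    by (auto simp: betti_elements_def M_eq)
  from betti_factorization_lift[OF b w] obtain v where "set_mset v \<subseteq> I" "w = lift v" by blast
  with w val_lift show "b \<in> N" by (auto simp: N_eq)
qed

text \<open>Lifting both summands of a nontrivial splitting of \<open>q n\<close> in
  \<open>N\<close> gives a factorization other than the isolated block.\<close>

lemma antimatter_subset_betti:
  assumes "antimatter N"
  shows "q ` I \<subseteq> betti_elements M"
proof
  fix x assume "x \<in> q ` I"
  then obtain n where n: "n \<in> I" "x = q n" by blast
  then have "q n \<in> N" by (auto simp: N_eq intro: exI[of _ "{#n#}"])
  moreover have "q n \<notin> atoms N" "q n \<noteq> 0"
    using assms q_pos[OF n(1)] by (auto simp: antimatter_def)
  ultimately obtain b c where bc: "b \<in> N" "c \<in> N" "b \<noteq> 0" "c \<noteq> 0" "q n = b + c"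
    by (auto simp: atoms_def)
  then obtain v w where vw: "set_mset v \<subseteq> I" "set_mset w \<subseteq> I" "b = val (lift v)" "c = val (lift w)"
    by (auto simp: N_eq val_lift)
  let ?u = "lift v + lift w" and ?r = "replicate_mset (p n) n"
  have u: "set_mset ?u \<subseteq> I" "val ?u = q n" using vw bc set_lift by auto
  \<comment> \<open>If they were equal, each of the two nonempty lifts would contain a full block of
    \<open>n\<close>, giving at least \<open>2 * p n\<close> copies instead of
    \<open>p n\<close>.\<close>
  have ne: "?u \<noteq> ?r"
  proof
    assume eq: "?u = ?r"
    have "lift v \<noteq> {#}" "lift w \<noteq> {#}" using vw bc by auto
    then have "set_mset (lift v) = {n}" "set_mset (lift w) = {n}"
      using arg_cong[OF eq, of set_mset] by (auto split: if_splits)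
    then have "n \<in># v" "n \<in># w" using set_lift vw by blast+
    then obtain v' w' where "v = add_mset n v'" "w = add_mset n w'" by (meson multi_member_split)
    then have "?u = ?r + (?r + lift v' + lift w')" by (simp add: lift_def)
    with eq have "?r = {#}" by simp
    with p_pos[OF n(1)] show False by simp
  qed
  have "image_mset atom ?r \<noteq> image_mset atom ?u"
  proof
    assume "image_mset atom ?r = image_mset atom ?u"
    moreover have "set_mset ?r \<subseteq> I" using n by auto
    ultimately have "?r = ?u" using image_mset_atom_inj u(1) by blast
    with ne show False by simp
  qed
  then have "disconnected (betti_graph M (q n))"
    using isolated_vertex_disconnected[OF isolated_vertex_replicate[OF n(1)], of "image_mset atom ?u"]
      factorizationsI[OF u] by (simp add: betti_graph_def)
  moreover have "q n \<in> M" unfolding M_eq by (rule CollectI, rule exI[of _ ?u]) (use u in simp)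
  ultimately show "x \<in> betti_elements M" using n by (simp add: betti_elements_def)
qed

text \<open>If \<open>q j\<close> divides \<open>q i\<close> in \<open>N\<close>, trading one block of \<open>atom i\<close> for blocks containing one of
  \<open>atom j\<close> gives a neighbour of \<open>lift v\<close>; since \<open>b \<noteq> q i\<close>, some other block remains to be shared.\<close>
lemma exchange:
  assumes "i \<in> I" "j \<in> I" "divides_in N (q j) (q i)" "b \<noteq> q i"
    and "set_mset v \<subseteq> I" "i \<in># v" "val (lift v) = b"
  shows "\<exists>y. set_mset y \<subseteq> I \<and> val y = b \<and> j \<in># y \<and> (\<exists>k. k \<in># lift v \<and> k \<in># y)"
proof -
  obtain u where u: "set_mset u \<subseteq> I" "q i = q j + val (lift u)"
    using assms(3) by (auto simp: divides_in_def N_eq val_lift)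
  obtain v' where v': "v = add_mset i v'" using assms(6) by (meson multi_member_split)
  have sub: "set_mset v' \<subseteq> I" using assms(5) v' by simp
  have b: "b = q i + val (lift v')"
    using assms(7) v' val_replicate[OF assms(1)] by (simp add: lift_def)
  then have "lift v' \<noteq> {#}" using assms(4) by auto
  then obtain k where k: "k \<in># lift v'" by blast
  let ?y = "replicate_mset (p j) j + lift u + lift v'"
  have "val ?y = b" using b u val_replicate[OF assms(2)] by simp
  moreover have "set_mset ?y \<subseteq> I" using assms(2) set_lift[OF u(1)] set_lift[OF sub] u sub by auto
  moreover have "j \<in># ?y" using p_pos[OF assms(2)] by simp
  moreover have "k \<in># lift v" using k v' by (simp add: lift_def)
  ultimately show ?thesis using k by (intro exI[of _ ?y]) auto
qed

lemma valuation_betti_subset: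
  assumes "valuation_monoid N"
  shows "betti_elements M \<subseteq> q ` I"
proof (rule subsetI, rule ccontr)
  fix b assume b: "b \<in> betti_elements M" "b \<notin> q ` I"
  have "\<not> disconnected (betti_graph M b)"
  proof (rule not_disconnected_betti_graphI)
    fix z z' assume z: "z \<in> factorizations M b" "z' \<in> factorizations M b" "z \<noteq> z'"
    have "\<exists>v. set_mset v \<subseteq> I \<and> val (lift v) = b \<and> z = image_mset atom (lift v)"
      if "z \<in> factorizations M b" for z
      using that
    proof (rule factorizationsE)
      fix u assume "set_mset u \<subseteq> I" "val u = b" "z = image_mset atom u"
      with betti_factorization_lift[OF b(1), of u] show ?thesis by blast
    qed
    from this[OF z(1)] this[OF z(2)]
    obtain v w where v: "set_mset v \<subseteq> I" "val (lift v) = b" "z = image_mset atom (lift v)"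
      and w: "set_mset w \<subseteq> I" "val (lift w) = b" "z' = image_mset atom (lift w)"
      by blast
    \<comment> \<open>An empty factorization would force \<open>b = 0\<close>, hence both to be
      empty, contradicting \<open>z \<noteq> z'\<close>.\<close>
    have "lift v \<noteq> {#} \<and> lift w \<noteq> {#}"
      using v w z(3) val_pos[of "lift v"] val_pos[of "lift w"] by (auto simp: set_lift)
    then have "v \<noteq> {#}" "w \<noteq> {#}" by (auto simp: lift_def)
    then obtain i j where i: "i \<in># v" and j: "j \<in># w" by blast
    then have ij: "i \<in> I" "j \<in> I" using v w by auto
    then have "q i \<in> N" "q j \<in> N"
      by (auto simp: N_eq intro: exI[of _ "{#i#}"] exI[of _ "{#j#}"])
    then have dv: "divides_in N (q j) (q i) \<or> divides_in N (q i) (q j)"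
      using assms by (auto simp: valuation_monoid_def)
    have mem: "i \<in># lift v" "j \<in># lift w" using i j set_lift v w by auto
    have neq: "b \<noteq> q i" "b \<noteq> q j" using b(2) ij by auto
    \<comment> \<open>If \<open>q j\<close> divides \<open>q i\<close>, the exchange takes place in
      \<open>lift v\<close> and \<open>y\<close> meets \<open>lift w\<close> in \<open>j\<close>; in
      the other case the roles are swapped and \<open>y\<close> meets \<open>lift v\<close> in
      \<open>i\<close>.\<close>
    have "\<exists>y. set_mset y \<subseteq> I \<and> val y = b \<and>
        (\<exists>k. k \<in># lift v \<and> k \<in># y) \<and> (\<exists>k. k \<in># y \<and> k \<in># lift w)"
      using dv exchange[OF ij _ neq(1) v(1) i v(2)] exchange[OF ij(2,1) _ neq(2) w(1) j w(2)] mem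
      by blast
    then obtain y where "set_mset y \<subseteq> I" "val y = b"
      "image_mset atom (lift v) \<inter># image_mset atom y \<noteq> {#}"
      "image_mset atom y \<inter># image_mset atom (lift w) \<noteq> {#}"
      using common_atom by metis
    then show "\<exists>y\<in>factorizations M b. z \<inter># y \<noteq> {#} \<and> y \<inter># z' \<noteq> {#}"
      using v w factorizationsI by blast
  qed
  with b(1) show False by (simp add: betti_elements_def)
qed

end

theorem theorem4p2:
  fixes q :: "nat \<Rightarrow> rat" and p :: "nat \<Rightarrow> nat" and M :: "rat set"
  assumes q_pos: "\<And>n. n \<ge> 1 \<Longrightarrow> q n > 0"
    and p_prime: "\<And>n. n \<ge> 1 \<Longrightarrow> prime (p n)"
    and p_distinct: "inj_on p {1..}"
    and gcd_num: "\<And>i. i \<ge> 1 \<Longrightarrow> gcd (int (p i)) (rat_num (q i)) = 1"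
    and gcd_den: "\<And>i j. i \<ge> 1 \<Longrightarrow> j \<ge> 1 \<Longrightarrow> gcd (int (p i)) (rat_den (q j)) = 1"
    and M_def: "M = gen_monoid {q n / of_nat (p n) | n. n \<ge> 1}"
  shows "(\<forall>j\<ge>1. isolated_vertex (betti_graph M (q j))
                  (replicate_mset (p j) (q j / of_nat (p j)))) \<and>
         betti_elements M \<subseteq> gen_monoid {q n | n. n \<ge> 1} \<and>
         (antimatter (gen_monoid {q n | n. n \<ge> 1}) \<longrightarrow>
            {q n | n. n \<ge> 1} \<subseteq> betti_elements M) \<and>
         (valuation_monoid (gen_monoid {q n | n. n \<ge> 1}) \<longrightarrow>
            betti_elements M \<subseteq> {q n | n. n \<ge> 1})"
proof -
  \<comment> \<open>The index set \<open>{1..}\<close> carries the side condition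
    \<open>n \<ge> 1\<close>.\<close>
  interpret A: atomized_sequence "{1..}" q p
    using assms by unfold_locales (auto simp: coprime_iff_gcd_eq_1)
  have "{q n / of_nat (p n) | n. n \<ge> 1} = A.atom ` {1..}"
    by (auto simp: A.atom_def)
  then have M: "M = A.M" unfolding M_def A.M_def by (rule arg_cong)
  have Q: "{q n | n. n \<ge> 1} = q ` {1..}" by auto
  have N: "gen_monoid (q ` {1..}) = A.N" by (rule A.N_def[symmetric])
  show ?thesis
    unfolding M Q N
    using A.isolated_vertex_replicate[unfolded A.atom_def] A.betti_subset_N
      A.antimatter_subset_betti A.valuation_betti_subset
    by (meson atLeast_iff)
qed

end
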